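(* Let $f,\mu,u_0$ satisfy assumptions (A1)–(A4) listed in the context, and suppose there exists $\overline h\in\mathbb{R}$ such that $f(\overline h,\mu(\{u_0<\overline h\}))\le 0\le f(\overline h,\mu(\{u_0\le\overline h\}))$. Let $u$ be the unique continuous viscosity solution of the Cauchy problem in the context satisfying the growth condition stated there. Then for any compact set $K\subset\mathbb{R}^n$, $u(\cdot,t)\to\overline h$ uniformly in $K$ as $t\to\infty$.
   Context: Setting. $\mathcal{B}$ is the family of Lebesgue measurable subsets of $\mathbb{R}^n$; $f:\mathbb{R}\times[0,\infty)\to\mathbb{R}$, $\mu:\mathcal{B}\to[0,\infty)$, $u_0:\mathbb{R}^n\to\mathbb{R}$. (A1) $f$ is bounded and continuous, and there is a modulus of continuity $\omega_f$ with $|f(r,q_1)-f(r,q_2)|\le\omega_f(|q_1-q_2|)$ for all $r\in\mathbb{R}$, $q_1,q_2\ge0$. (A2) $f(r_1,q)\le f(r_2,q)$ for $r_1<r_2$, $q\ge0$; and $f(r,q_1)<f(r,q_2)$ for $r\in\mathbb{R}$, $0\le q_1<q_2$. (A3) $\mu(A)=\int_A\Theta(x)\,dx$ for $A\in\mathcal{B}$, where $\Theta\in L^1(\mathbb{R}^n)$, $\Theta>0$ in $\mathbb{R}^n$. (A4) $u_0$ is uniformly continuous and $\lim_{R\to\infty}\inf\{u_0(y):|y|\ge R\}>u_0(x)$ for every $x\in\mathbb{R}^n$. Cauchy problem: $u_t(x,t)+|\nabla u(x,t)|f(u(x,t),\mu(\{u(\cdot,t)<u(x,t)\}))=0$ in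 $\mathbb{R}^n\times(0,\infty)$, $u(\cdot,0)=u_0$. Growth condition: for any $T>0$ there is $M_T>0$ with $|u(x,t)|\le M_T(|x|+1)$ on $\mathbb{R}^n\times[0,T]$. Viscosity solution: a locally bounded upper semicontinuous $u$ is a subsolution if whenever $\varphi\in C^1$ and $u-\varphi$ has a local maximum at $(x_0,t_0)$, $t_0>0$, then $\varphi_t+|\nabla\varphi|f(u,\mu(\{u(\cdot,t_0)<u(x_0,t_0)\}))\le0$ at $(x_0,t_0)$; a locally bounded lower semicontinuous $u$ is a supersolution if whenever $\varphi\in C^1$ and $u-\varphi$ has a local minimum at $(x_0,t_0)$, $t_0>0$, then $\varphi_t+|\nabla\varphi|f(u,\mu(\{u(\cdot,t_0)\le u(x_0,t_0)\}))\ge0$ at $(x_0,t_0)$; a continuous function that is both is a solution. Under (A1)–(A4) and existence of $\overline h$, a unique continuous solution $u$ with the growth condition exists.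
   Formalization: The formal statement adds that h̄ lies in the closure of the range of u_0 (inf u_0 ≤ h̄ ≤ sup u_0); without it the claim fails, e.g. n=1, u_0=|x|, f(r,q)=q for q≤1 and 2−1/q for q≥1, Θ=sech²(x)/2, where every h̄<0 satisfies the inequalities but u→0. *)

theory Defs
  imports "HOL-Analysis.Analysis"
begin

section \<open>Assumptions on the data\<close>

text \<open>Functions on \<open>[0,\<infinity>)\<close> are represented by functions on all reals; only their values at
  nonnegative arguments are ever constrained or used.\<close>

definition modulus_of_continuity :: "(real \<Rightarrow> real) \<Rightarrow> bool" where
  "modulus_of_continuity \<omega> \<longleftrightarrow> \<omega> 0 = 0 \<and> mono_on {0..} \<omega> \<and> continuous_on {0..} \<omega>"

definition assumption_A1 :: "(real \<Rightarrow> real \<Rightarrow> real) \<Rightarrow> bool" where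
  "assumption_A1 f \<longleftrightarrow>
     bounded ((\<lambda>(r, q). f r q) ` (UNIV \<times> {0..})) \<and>
     continuous_on (UNIV \<times> {0..}) (\<lambda>(r, q). f r q) \<and>
     (\<exists>\<omega>. modulus_of_continuity \<omega> \<and>
        (\<forall>r q1 q2. 0 \<le> q1 \<longrightarrow> 0 \<le> q2 \<longrightarrow> \<bar>f r q1 - f r q2\<bar> \<le> \<omega> \<bar>q1 - q2\<bar>))"

definition assumption_A2 :: "(real \<Rightarrow> real \<Rightarrow> real) \<Rightarrow> bool" where
  "assumption_A2 f \<longleftrightarrow>
     (\<forall>r1 r2 q. r1 < r2 \<longrightarrow> 0 \<le> q \<longrightarrow> f r1 q \<le> f r2 q) \<and>
     (\<forall>r q1 q2. 0 \<le> q1 \<longrightarrow> q1 < q2 \<longrightarrow> f r q1 < f r q2)"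

definition assumption_A3 :: "((real ^ 'n) set \<Rightarrow> real) \<Rightarrow> bool" where
  "assumption_A3 \<mu> \<longleftrightarrow>
     (\<exists>\<Theta>. integrable lebesgue \<Theta> \<and> (\<forall>x. 0 < \<Theta> x) \<and>
        (\<forall>A \<in> sets lebesgue. \<mu> A = set_lebesgue_integral lebesgue A \<Theta>))"

text \<open>The limit below exists in the extended reals by monotonicity; it is \<open>\<infinity>\<close> for coercive
  \<open>u0\<close>.\<close>

definition assumption_A4 :: "(real ^ 'n \<Rightarrow> real) \<Rightarrow> bool" where
  "assumption_A4 u0 \<longleftrightarrow>
     uniformly_continuous_on UNIV u0 \<and>
     (\<exists>L :: ereal. ((\<lambda>R :: real. INF y \<in> {y. R \<le> norm y}. ereal (u0 y)) \<longlongrightarrow> L) at_top \<and>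
        (\<forall>x. ereal (u0 x) < L))"


section \<open>Viscosity solutions\<close>

text \<open>Space-time functions take a pair \<open>(x, t)\<close>.\<close>

abbreviation spacetime :: "((real ^ 'n) \<times> real) set" where
  "spacetime \<equiv> UNIV \<times> {0<..}"

definition locally_bounded_on :: "'a::topological_space set \<Rightarrow> ('a \<Rightarrow> real) \<Rightarrow> bool" where
  "locally_bounded_on S u \<longleftrightarrow> (\<forall>z \<in> S. \<exists>U. open U \<and> z \<in> U \<and> bounded (u ` (U \<inter> S)))"

definition usc_on :: "'a::topological_space set \<Rightarrow> ('a \<Rightarrow> real) \<Rightarrow> bool" where
  "usc_on S u \<longleftrightarrow> (\<forall>z \<in> S. \<forall>a. u z < a \<longrightarrow> (\<forall>\<^sub>F w in at z within S. u w < a))"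

definition lsc_on :: "'a::topological_space set \<Rightarrow> ('a \<Rightarrow> real) \<Rightarrow> bool" where
  "lsc_on S u \<longleftrightarrow> (\<forall>z \<in> S. \<forall>a. a < u z \<longrightarrow> (\<forall>\<^sub>F w in at z within S. a < u w))"

text \<open>\<open>\<phi>\<close> is of class C1 on the open set \<open>S\<close> with gradient \<open>G\<close>. For \<open>S = spacetime\<close> the
  gradient is a pair: \<open>fst (G z)\<close> is the spatial gradient and \<open>snd (G z)\<close> the time derivative.\<close>

definition C1_with_gradient ::
  "'a::real_inner set \<Rightarrow> ('a \<Rightarrow> real) \<Rightarrow> ('a \<Rightarrow> 'a) \<Rightarrow> bool" where
  "C1_with_gradient S \<phi> G \<longleftrightarrow> (\<forall>z \<in> S. GDERIV \<phi> z :> G z) \<and> continuous_on S G"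

definition local_max_at :: "('a::topological_space \<Rightarrow> real) \<Rightarrow> 'a \<Rightarrow> bool" where
  "local_max_at g z \<longleftrightarrow> (\<forall>\<^sub>F w in nhds z. g w \<le> g z)"

definition local_min_at :: "('a::topological_space \<Rightarrow> real) \<Rightarrow> 'a \<Rightarrow> bool" where
  "local_min_at g z \<longleftrightarrow> (\<forall>\<^sub>F w in nhds z. g z \<le> g w)"

text \<open>Note the strict sublevel set for subsolutions and the nonstrict one for supersolutions.\<close>

definition viscosity_subsolution ::
  "(real \<Rightarrow> real \<Rightarrow> real) \<Rightarrow> ((real ^ 'n) set \<Rightarrow> real) \<Rightarrow> ((real ^ 'n) \<times> real \<Rightarrow> real) \<Rightarrow> bool" where
  "viscosity_subsolution f \<mu> u \<longleftrightarrow>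
     locally_bounded_on spacetime u \<and> usc_on spacetime u \<and>
     (\<forall>\<phi> G x0 t0. C1_with_gradient spacetime \<phi> G \<longrightarrow> 0 < t0 \<longrightarrow>
        local_max_at (\<lambda>z. u z - \<phi> z) (x0, t0) \<longrightarrow>
        snd (G (x0, t0)) +
          norm (fst (G (x0, t0))) * f (u (x0, t0)) (\<mu> {y. u (y, t0) < u (x0, t0)}) \<le> 0)"

definition viscosity_supersolution ::
  "(real \<Rightarrow> real \<Rightarrow> real) \<Rightarrow> ((real ^ 'n) set \<Rightarrow> real) \<Rightarrow> ((real ^ 'n) \<times> real \<Rightarrow> real) \<Rightarrow> bool" where
  "viscosity_supersolution f \<mu> u \<longleftrightarrow>
     locally_bounded_on spacetime u \<and> lsc_on spacetime u \<and>
     (\<forall>\<phi> G x0 t0. C1_with_gradient spacetime \<phi> G \<longrightarrow> 0 < t0 \<longrightarrow>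
        local_min_at (\<lambda>z. u z - \<phi> z) (x0, t0) \<longrightarrow>
        snd (G (x0, t0)) +
          norm (fst (G (x0, t0))) * f (u (x0, t0)) (\<mu> {y. u (y, t0) \<le> u (x0, t0)}) \<ge> 0)"

text \<open>Continuity is required up to \<open>t = 0\<close>, so that the initial value is attained
  continuously.\<close>

definition cauchy_viscosity_solution ::
  "(real \<Rightarrow> real \<Rightarrow> real) \<Rightarrow> ((real ^ 'n) set \<Rightarrow> real) \<Rightarrow> (real ^ 'n \<Rightarrow> real) \<Rightarrow>
     ((real ^ 'n) \<times> real \<Rightarrow> real) \<Rightarrow> bool" where
  "cauchy_viscosity_solution f \<mu> u0 u \<longleftrightarrow>
     continuous_on (UNIV \<times> {0..}) u \<and>
     viscosity_subsolution f \<mu> u \<and> viscosity_supersolution f \<mu> u \<and>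
     (\<forall>x. u (x, 0) = u0 x)"

definition growth_condition :: "((real ^ 'n) \<times> real \<Rightarrow> real) \<Rightarrow> bool" where
  "growth_condition u \<longleftrightarrow>
     (\<forall>T>0. \<exists>M>0. \<forall>x. \<forall>t \<in> {0..T}. \<bar>u (x, t)\<bar> \<le> M * (norm x + 1))"

section \<open>On the admissible levels\<close>

text \<open>
  A level \<open>h\<close> with \<open>f h (\<mu> {u0 < h}) \<le> 0 \<le> f h (\<mu> {u0 \<le> h})\<close> can only be the large-time limit
  if \<open>inf u0 \<le> h \<le> sup u0\<close>, because \<open>u\<close> takes its values between these bounds. The two
  inequalities alone do not ensure this: for \<open>h < inf u0\<close> both sublevel sets are empty and they
  just say \<open>f h 0 = 0\<close>, and for \<open>h > sup u0\<close> both sets are the whole space. Hence the level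
  describing the limit is required to be in the closure of the range of \<open>u0\<close>. As \<open>u0\<close> is continuous, its
  range is an interval, so this means exactly \<open>inf u0 \<le> h \<le> sup u0\<close>.

  Without it the limit statement fails. In dimension one take the density
  \<open>\<Theta> x = 1 / (2 * cosh x ^ 2)\<close>, \<open>f r q = q\<close> for \<open>q \<le> 1\<close> and \<open>2 - 1 / q\<close> for \<open>q \<ge> 1\<close>, and
  \<open>u0 x = \<bar>x\<bar>\<close>. The solution is \<open>u (x, t) = arsinh (exp (- t) * sinh \<bar>x\<bar>)\<close>, which tends to \<open>0\<close>,
  although every \<open>h < 0\<close> satisfies the two inequalities.
\<close>

end

theory Submission
  imports Defs "HOL-Real_Asymp.Real_Asymp"
begin

text \<open>
  Both \<open>u\<close> and \<open>- u\<close> are subsolutions of \<open>v\<^sub>t + |\<nabla>v| F = 0\<close>, where \<open>F\<close> is the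
  value of \<open>f\<close> (respectively \<open>- f\<close>) along \<open>u\<close>. By monotonicity of \<open>f\<close> and strict
  monotonicity of the measure, if \<open>v\<close> stays below a level \<open>b\<close> beyond the limit level on a set \<open>A\<close>
  where it starts below \<open>b\<close>, then \<open>F \<ge> c > 0\<close> wherever \<open>v > b\<close>, so the sublevel set grows with
  speed at least \<open>c\<close> and swallows every compact set. The circularity is broken with a level
  \<open>b + e t\<close> that rises slowly up to time \<open>S\<close>: before the first time \<open>v\<close> touches this level on
  \<open>A\<close> the coefficient is at least \<open>c\<close>, hence \<open>v \<le> b + e t\<close> on a whole neighbourhood of the
  touching point, and there the positive time derivative \<open>e\<close> contradicts the subsolution property.
\<close>

section \<open>Gradients of the building blocks of the barriers\<close>

lemma GDERIV_sqdist_fst: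
  fixes y :: "'a::real_inner" and z :: "'a \<times> real"
  shows "GDERIV (\<lambda>z. (norm (fst z - y))\<^sup>2) z :> (2 *\<^sub>R (fst z - y), 0)"
  unfolding gderiv_def power2_norm_eq_inner
  by (auto intro!: derivative_eq_intros simp: inner_prod_def inner_commute fun_eq_iff
      inner_diff_left inner_diff_right)

lemma GDERIV_real_snd:
  fixes z :: "'a::real_inner \<times> real"
  assumes "(p has_real_derivative p') (at (snd z))"
  shows "GDERIV (\<lambda>z. p (snd z)) z :> (0, p')"
proof -
  have "GDERIV (snd :: 'a \<times> real \<Rightarrow> real) z :> (0, 1)"
    unfolding gderiv_def by (auto intro!: derivative_eq_intros simp: inner_prod_def fun_eq_iff)
  from GDERIV_DERIV_compose[OF this assms] show ?thesis by (simp add: scaleR_prod_def)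
qed

text \<open>Squaring removes the corner of the positive part, so that a barrier which is flat in
  space inside a moving ball is still an admissible C1 test function.\<close>

lemma DERIV_pos_part_sq: "((\<lambda>s. (max 0 s)\<^sup>2) has_real_derivative 2 * max 0 x) (at x)"
proof (cases "x = 0")
  case True
  have "((\<lambda>h::real. (max 0 h)\<^sup>2 / h) \<longlongrightarrow> 0) (at 0)"
  proof (rule Lim_null_comparison)
    show "((\<lambda>h::real. \<bar>h\<bar>) \<longlongrightarrow> 0) (at 0)" by (auto intro!: tendsto_eq_intros)
    show "\<forall>\<^sub>F h::real in at 0. norm ((max 0 h)\<^sup>2 / h) \<le> \<bar>h\<bar>"
      by (auto simp: max_def power2_eq_square)
  qed
  then show ?thesis using True by (simp add: DERIV_def)
next
  case False
  show ?thesis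
  proof (cases "x > 0")
    case True
    then have "\<forall>\<^sub>F s in nhds x. s > 0" using eventually_nhds_in_open[of "{0<..}" x] by auto
    then have "\<forall>\<^sub>F s in nhds x. (max 0 s)\<^sup>2 = s\<^sup>2" by eventually_elim simp
    moreover have "((\<lambda>s. s\<^sup>2) has_real_derivative 2 * x) (at x)"
      by (auto intro!: derivative_eq_intros)
    ultimately show ?thesis using True by (subst DERIV_cong_ev[OF refl _ refl]) auto
  next
    case xneg: False
    then have "\<forall>\<^sub>F s in nhds x. s < 0"
      using False eventually_nhds_in_open[of "{..<0}" x] by auto
    then have "\<forall>\<^sub>F s in nhds x. (max 0 s)\<^sup>2 = 0" by eventually_elim simp
    moreover have "((\<lambda>s. 0) has_real_derivative 2 * max 0 x) (at x)"
      using xneg by (auto simp: max_def)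
    ultimately show ?thesis by (subst DERIV_cong_ev[OF refl _ refl]) auto
  qed
qed

section \<open>Comparison with C1 barriers on space-time cylinders\<close>

text \<open>The coefficient \<open>F\<close> is frozen: any bounded function of the space-time point
  will do, continuous or not. The nonlocal dependence on the solution is thus hidden from the
  comparison arguments, and \<open>u\<close> and \<open>- u\<close> become two instances.\<close>

locale eikonal_subsolution =
  fixes v F :: "(real ^ 'n) \<times> real \<Rightarrow> real" and C :: real
  assumes cont: "continuous_on (UNIV \<times> {0..}) v"
    and growth: "growth_condition v"
    and test: "\<And>\<phi> G x0 t0. C1_with_gradient spacetime \<phi> G \<Longrightarrow> 0 < t0 \<Longrightarrow>
        local_max_at (\<lambda>z. v z - \<phi> z) (x0, t0) \<Longrightarrow>
        snd (G (x0, t0)) + norm (fst (G (x0, t0))) * F (x0, t0) \<le> 0"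
    and C_pos: "0 < C"
    and F_bound: "\<And>x t. 0 < t \<Longrightarrow> \<bar>F (x, t)\<bar> \<le> C"
begin

text \<open>A term \<open>d (\<tau> / t)\<^sup>N\<close> with large \<open>N\<close> is added to \<open>\<Phi>\<close>: it keeps the maximum away from the
  final time and, unlike the customary \<open>d / (t1 - \<tau>)\<close>, is C1 on the whole of space-time.\<close>

lemma max_principle_open:
  assumes C1: "C1_with_gradient spacetime \<Phi> G"
    and cont\<Phi>: "continuous_on (cball y R \<times> {s..t1}) \<Phi>"
    and s: "0 \<le> s"
    and init: "\<And>x. x \<in> cball y R \<Longrightarrow> v (x, s) \<le> \<Phi> (x, s)"
    and lateral: "\<And>x t. dist y x = R \<Longrightarrow> s \<le> t \<Longrightarrow> t \<le> t1 \<Longrightarrow> v (x, t) \<le> \<Phi> (x, t)"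
    and ineq: "\<And>x t. dist y x < R \<Longrightarrow> s < t \<Longrightarrow> t < t1 \<Longrightarrow> \<Phi> (x, t) < v (x, t) \<Longrightarrow>
        0 \<le> snd (G (x, t)) + norm (fst (G (x, t))) * F (x, t)"
    and xt: "x \<in> cball y R" "s \<le> t" "t < t1"
  shows "v (x, t) \<le> \<Phi> (x, t)"
proof (rule ccontr)
  assume neg: "\<not> v (x, t) \<le> \<Phi> (x, t)"
  have "t \<noteq> s" using init[OF xt(1)] neg by auto
  then have t: "s < t" "0 < t" using xt s by auto
  define d where "d = (v (x, t) - \<Phi> (x, t)) / 2"
  have d: "0 < d" using neg by (simp add: d_def)
  let ?D = "cball y R \<times> {s..t1}"
  have comp: "compact ?D" by (intro compact_Times) auto
  have contv: "continuous_on ?D v" by (rule continuous_on_subset[OF cont]) (use s in auto)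
  have contg: "continuous_on ?D (\<lambda>z. v z - \<Phi> z)"
    by (intro continuous_on_diff contv cont\<Phi>)
  obtain B where B: "\<And>z. z \<in> ?D \<Longrightarrow> v z - \<Phi> z \<le> B"
    using bounded_imp_bdd_above[OF compact_imp_bounded[OF compact_continuous_image[OF contg comp]]]
    unfolding bdd_above_def by blast
  \<comment> \<open>The penalty \<open>P\<close> equals \<open>d\<close>, half of the violation, at
    time \<open>t\<close>, so an excess \<open>d\<close> survives at \<open>(x, t)\<close>. The
    choice of \<open>N\<close> gives \<open>P t1 > B\<close>, which leaves no positive excess at
    time \<open>t1\<close>.\<close>
  obtain N where N: "B / d < (t1 / t) ^ N" using real_arch_pow[of "t1 / t" "B / d"] t xt by auto
  define P where "P = (\<lambda>\<tau>. d * (\<tau> / t) ^ Suc N)"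
  have P1: "B < P t1"
  proof -
    have "(t1 / t) ^ N \<le> (t1 / t) ^ Suc N" using t xt by (intro power_increasing) auto
    with N have "B / d < (t1 / t) ^ Suc N" by simp
    with d show ?thesis by (simp add: P_def divide_less_eq mult.commute del: power_Suc)
  qed
  have P0: "0 \<le> P \<tau>" if "0 \<le> \<tau>" for \<tau> using that d t by (simp add: P_def)
  have Pt: "P t = d" using t by (simp add: P_def)
  have contw: "continuous_on ?D (\<lambda>z. v z - (\<Phi> z + P (snd z)))"
    using t unfolding P_def
    by (intro continuous_on_diff contv continuous_on_add cont\<Phi>) (auto intro!: continuous_intros)
  obtain z' where z': "z' \<in> ?D" "\<And>z. z \<in> ?D \<Longrightarrow> v z - (\<Phi> z + P (snd z)) \<le> v z' - (\<Phi> z' + P (snd z'))"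
    using continuous_attains_sup[OF comp _ contw] xt by fastforce
  obtain x' t' where z'eq: "z' = (x', t')" by force
  have "v (x, t) - (\<Phi> (x, t) + P t) \<le> v z' - (\<Phi> z' + P t')"
    using z'(2)[of "(x, t)"] xt z'eq by auto
  moreover have "v (x, t) - (\<Phi> (x, t) + P t) = d" unfolding Pt by (simp add: d_def field_simps)
  ultimately have pos: "d \<le> v z' - (\<Phi> z' + P t')" by simp
  have t': "s \<le> t'" "t' \<le> t1" "dist y x' \<le> R" using z' z'eq by auto
  have gt: "\<Phi> (x', t') < v (x', t')" using pos d P0[of t'] t' s z'eq by auto
  have "t' \<noteq> t1" using B[OF z'(1)] P1 pos d by auto
  moreover have "t' \<noteq> s" using init[of x'] t' gt by auto
  moreover have "dist y x' \<noteq> R" using lateral[of x' t'] t' gt by auto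
  ultimately have t'': "s < t'" "t' < t1" "dist y x' < R" using t' by auto
  have lm: "local_max_at (\<lambda>z. v z - (\<Phi> z + P (snd z))) (x', t')"
    unfolding local_max_at_def
  proof -
    have "\<forall>\<^sub>F w in nhds (x', t'). w \<in> ball y R \<times> {s<..<t1}"
      using t'' by (intro eventually_nhds_in_open open_Times) auto
    then show "\<forall>\<^sub>F w in nhds (x', t'). v w - (\<Phi> w + P (snd w)) \<le> v (x', t') - (\<Phi> (x', t') + P (snd (x', t')))"
      by eventually_elim (use z'(2) z'eq in auto)
  qed
  define P' where "P' = (\<lambda>\<tau>. d * (real (Suc N) * (\<tau> / t) ^ N * (1 / t)))"
  have dP: "(P has_real_derivative P' \<tau>) (at \<tau>)" for \<tau>
    unfolding P_def P'_def using t by (auto intro!: derivative_eq_intros simp del: power_Suc)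
  have contP': "continuous_on UNIV P'" unfolding P'_def using t by (intro continuous_intros) auto
  have C1': "C1_with_gradient spacetime (\<lambda>z. \<Phi> z + P (snd z)) (\<lambda>z. G z + (0, P' (snd z)))"
    using C1 t unfolding C1_with_gradient_def
    by (auto intro!: GDERIV_add GDERIV_real_snd dP continuous_intros continuous_on_compose2[OF contP'])
  have "snd (G (x', t')) + P' t' + norm (fst (G (x', t'))) * F (x', t') \<le> 0"
    using test[OF C1' _ lm] t'' s by simp
  moreover have "0 \<le> snd (G (x', t')) + norm (fst (G (x', t'))) * F (x', t')"
    using ineq t'' gt by blast
  moreover have "0 < P' t'" using d t t'' s by (simp add: P'_def)
  ultimately show False by simp
qed

text \<open>The penalised argument only reaches times before \<open>t1\<close>; the final time
  follows by continuity, since it lies in the closure of \<open>{s..<t1}\<close>.\<close>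

lemma max_principle:
  assumes C1: "C1_with_gradient spacetime \<Phi> G"
    and cont\<Phi>: "continuous_on (cball y R \<times> {s..t1}) \<Phi>"
    and s: "0 \<le> s" "s < t1"
    and init: "\<And>x. x \<in> cball y R \<Longrightarrow> v (x, s) \<le> \<Phi> (x, s)"
    and lateral: "\<And>x t. dist y x = R \<Longrightarrow> s \<le> t \<Longrightarrow> t \<le> t1 \<Longrightarrow> v (x, t) \<le> \<Phi> (x, t)"
    and ineq: "\<And>x t. dist y x < R \<Longrightarrow> s < t \<Longrightarrow> t < t1 \<Longrightarrow> \<Phi> (x, t) < v (x, t) \<Longrightarrow>
        0 \<le> snd (G (x, t)) + norm (fst (G (x, t))) * F (x, t)"
    and xt: "x \<in> cball y R" "s \<le> t" "t \<le> t1"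
  shows "v (x, t) \<le> \<Phi> (x, t)"
proof -
  have "continuous_on {s..t1} (\<lambda>t. v (x, t) - \<Phi> (x, t))"
    using s xt
    by (intro continuous_on_diff continuous_on_compose2[OF cont, of _ "Pair x"]
        continuous_on_compose2[OF cont\<Phi>, of _ "Pair x"]) (auto intro!: continuous_intros)
  then have c: "continuous_on (closure {s..<t1}) (\<lambda>t. v (x, t) - \<Phi> (x, t))" using s by simp
  have "v (x, t) - \<Phi> (x, t) \<le> 0"
  proof (rule continuous_le_on_closure[OF c])
    show "t \<in> closure {s..<t1}" using s xt by simp
    show "v (x, t) - \<Phi> (x, t) \<le> 0" if "t \<in> {s..<t1}" for t
      using max_principle_open[OF C1 cont\<Phi> s(1) init lateral ineq xt(1)] that by auto
  qed
  then show ?thesis by simp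
qed

section \<open>Paraboloid barriers and bounds by the initial data\<close>

lemma growth_upper:
  "\<exists>M>0. \<forall>x t. 0 \<le> t \<longrightarrow> t \<le> T \<longrightarrow> v (x, t) \<le> M * (dist y x + norm y + 1)"
proof -
  have "0 < max T 1" by simp
  then obtain M where M: "M > 0" "\<And>x t. t \<in> {0..max T 1} \<Longrightarrow> \<bar>v (x, t)\<bar> \<le> M * (norm x + 1)"
    using growth unfolding growth_condition_def by metis
  show ?thesis
  proof (intro exI conjI allI impI)
    show "0 < M" by (rule M(1))
    fix x t assume "0 \<le> t" "t \<le> T"
    then have "t \<in> {0..max T 1}" by simp
    from M(2)[OF this, of x] have "v (x, t) \<le> M * (norm x + 1)" by linarith
    also have "\<dots> \<le> M * (dist y x + norm y + 1)"
      using M(1) norm_triangle_ineq[of "x - y" y] by (intro mult_left_mono) (auto simp: dist_norm norm_minus_commute)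
    finally show "v (x, t) \<le> M * (dist y x + norm y + 1)" .
  qed
qed

text \<open>With speed at most \<open>C\<close> and \<rho> the distance to \<open>y\<close>, the
  growth rate \<open>C * (\<rho>\<^sup>2 + 1)\<close> dominates the gradient term
  \<open>2 * C * \<rho>\<close>, the difference being
  \<open>C * (\<rho> - 1)\<^sup>2\<close>.\<close>

lemma paraboloid_barrier:
  assumes k: "0 < k"
    and init: "\<And>x. v (x, 0) \<le> a + k * ((dist y x)\<^sup>2 + 1)"
    and t: "0 \<le> t"
  shows "v (x, t) \<le> a + k * ((dist y x)\<^sup>2 + 1) * exp (C * t)"
proof -
  define T where "T = t + 1"
  obtain M where M: "0 < M" "\<And>x t. 0 \<le> t \<Longrightarrow> t \<le> T \<Longrightarrow> v (x, t) \<le> M * (dist y x + norm y + 1)"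
    using growth_upper[of T y] by auto
  \<comment> \<open>Quadratic growth of the barrier beats the linear growth of \<open>v\<close>,
    which settles the lateral boundary of a large cylinder.\<close>
  have "\<forall>\<^sub>F R in at_top. M * (R + norm y + 1) \<le> a + k * (R\<^sup>2 + 1)" using k M(1) by real_asymp
  then have "\<forall>\<^sub>F R in at_top. dist y x \<le> R \<and> M * (R + norm y + 1) \<le> a + k * (R\<^sup>2 + 1)"
    by (intro eventually_conj eventually_ge_at_top)
  then obtain R where R: "dist y x \<le> R" "M * (R + norm y + 1) \<le> a + k * (R\<^sup>2 + 1)"
    using eventually_happens'[OF trivial_limit_at_top_linorder] by blast
  define \<Phi> where "\<Phi> = (\<lambda>z. a + k * (((norm (fst z - y))\<^sup>2 + 1) * exp (C * snd z)))"
  define G where "G = (\<lambda>z. k *\<^sub>R (((norm (fst z - y))\<^sup>2 + 1) *\<^sub>R (0, C * exp (C * snd z)) + exp (C * snd z) *\<^sub>R (2 *\<^sub>R (fst z - y), 0)))"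
  have "GDERIV (\<lambda>z. (norm (fst z - y))\<^sup>2 + 1) z :> (2 *\<^sub>R (fst z - y), 0)" for z :: "(real ^ 'n) \<times> real"
    using GDERIV_add[OF GDERIV_sqdist_fst GDERIV_const] by simp
  moreover have "GDERIV (\<lambda>z. exp (C * snd z)) z :> (0, C * exp (C * snd z))" for z :: "(real ^ 'n) \<times> real"
    by (rule GDERIV_real_snd) (auto intro!: derivative_eq_intros)
  ultimately have "GDERIV (\<lambda>z. ((norm (fst z - y))\<^sup>2 + 1) * exp (C * snd z)) z :>
      (((norm (fst z - y))\<^sup>2 + 1) *\<^sub>R (0, C * exp (C * snd z)) + exp (C * snd z) *\<^sub>R (2 *\<^sub>R (fst z - y), 0))" for z :: "(real ^ 'n) \<times> real"
    by (rule GDERIV_mult)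
  from GDERIV_add[OF GDERIV_const GDERIV_mult[OF GDERIV_const this]]
  have "GDERIV \<Phi> z :> G z" for z
    unfolding \<Phi>_def G_def by (auto simp: scaleR_prod_def zero_prod_def)
  then have C1: "C1_with_gradient spacetime \<Phi> G"
    unfolding C1_with_gradient_def G_def by (auto intro!: continuous_intros)
  have cont\<Phi>: "continuous_on (cball y R \<times> {0..T}) \<Phi>" unfolding \<Phi>_def by (intro continuous_intros)
  have lateral: "v (x, t) \<le> \<Phi> (x, t)" if "dist y x = R" "0 \<le> t" "t \<le> T" for x t
  proof -
    have "v (x, t) \<le> a + k * (R\<^sup>2 + 1)" using M(2)[of t x] that R(2) by auto
    moreover have "k * (R\<^sup>2 + 1) * 1 \<le> k * (R\<^sup>2 + 1) * exp (C * t)" using C_pos k that by (intro mult_left_mono) auto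
    ultimately show ?thesis using that by (simp add: \<Phi>_def dist_norm norm_minus_commute mult_ac)
  qed
  have ineq: "0 \<le> snd (G (x, t)) + norm (fst (G (x, t))) * F (x, t)" if "0 < t" for x t
  proof -
    define \<rho> where "\<rho> = norm (x - y)"
    have "- C \<le> F (x, t)" using F_bound[OF that, of x] by auto
    have "norm (fst (G (x, t))) = k * exp (C * t) * (2 * \<rho>)" using k by (simp add: G_def \<rho>_def)
    moreover have "snd (G (x, t)) = k * exp (C * t) * (C * (\<rho>\<^sup>2 + 1))" using k by (simp add: G_def \<rho>_def)
    ultimately have eq: "snd (G (x, t)) + norm (fst (G (x, t))) * F (x, t)
      = k * exp (C * t) * (C * (\<rho>\<^sup>2 + 1) + 2 * \<rho> * F (x, t))" by (simp add: algebra_simps)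
    have "2 * \<rho> * (- C) \<le> 2 * \<rho> * F (x, t)" using \<open>- C \<le> F (x, t)\<close> by (intro mult_left_mono) (auto simp: \<rho>_def)
    moreover have "0 \<le> C * (\<rho> - 1)\<^sup>2" using C_pos by simp
    ultimately have "0 \<le> C * (\<rho>\<^sup>2 + 1) + 2 * \<rho> * F (x, t)" by (simp add: power2_eq_square algebra_simps)
    then show ?thesis unfolding eq using k by simp
  qed
  have "v (x, t) \<le> \<Phi> (x, t)"
    by (rule max_principle[OF C1 cont\<Phi> _ _ _ lateral ineq])
      (use init t R in \<open>auto simp: T_def \<Phi>_def dist_norm norm_minus_commute\<close>)
  then show ?thesis by (simp add: \<Phi>_def dist_norm norm_minus_commute mult_ac)
qed

text \<open>A paraboloid centred at the point itself exceeds \<open>a\<close> there by only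
  \<open>k * exp (C * t)\<close>, which can be made equal to any \<open>e > 0\<close>.\<close>

lemma upper_bound:
  assumes init: "\<And>x. v (x, 0) \<le> a" and t: "0 \<le> t"
  shows "v (x, t) \<le> a"
proof (rule field_le_epsilon)
  fix e :: real assume e: "0 < e"
  define k where "k = e / exp (C * t)"
  have "v (x, t) \<le> a + k * ((dist x x)\<^sup>2 + 1) * exp (C * t)"
  proof (rule paraboloid_barrier)
    show k: "0 < k" using e by (simp add: k_def)
    show "v (x', 0) \<le> a + k * ((dist x x')\<^sup>2 + 1)" for x'
      using add_mono[OF init[of x'], of 0 "k * ((dist x x')\<^sup>2 + 1)"] k by simp
  qed (rule t)
  then show "v (x, t) \<le> a + e" by (simp add: k_def)
qed

section \<open>Expansion of sublevel sets and contact with a rising level\<close>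

text \<open>The barrier adds to the rising level a multiple of the squared positive part of
  \<open>(dist y x)\<^sup>2 - (r + c * t)\<^sup>2\<close>, which vanishes on a ball expanding at
  speed \<open>c\<close>. A lower bound on \<open>F\<close> is required only above the level,
  because the maximum principle tests only points where \<open>v\<close> exceeds the
  barrier.\<close>

lemma expanding_barrier:
  assumes r: "0 < r" and c: "0 \<le> c" and e: "0 \<le> e"
    and init: "\<And>x. dist y x \<le> 2 * r \<Longrightarrow> v (x, 0) \<le> b"
    and speed: "\<And>x t. 0 < t \<Longrightarrow> t < t1 \<Longrightarrow> b + e * t < v (x, t) \<Longrightarrow> c \<le> F (x, t)"
    and xt: "dist y x \<le> r + c * t" "0 \<le> t" "t \<le> t1" "0 < t1"
  shows "v (x, t) \<le> b + e * t"
proof -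
  obtain M where M: "0 < M" "\<And>x t. 0 \<le> t \<Longrightarrow> t \<le> t1 \<Longrightarrow> v (x, t) \<le> M * (dist y x + norm y + 1)"
    using growth_upper[of t1 y] by auto
  \<comment> \<open>For \<rho> at least \<open>2 * r\<close>, the growth bound gives
    \<open>v - b \<le> M * \<rho> + E \<le> D * \<rho>\<close>. The choice of \<open>k\<close> gives
    \<open>D * \<rho> \<le> k * (r * \<rho>)\<^sup>2\<close>, and
    \<open>r * \<rho> \<le> \<rho>\<^sup>2 - r\<^sup>2\<close>, so the barrier dominates the initial
    values outside the larger ball.\<close>
  define E where "E = M * (norm y + 1) + \<bar>b\<bar>"
  define D where "D = M + E / (2 * r)"
  define k where "k = D / r ^ 3"
  have E: "0 \<le> E" using M(1) by (simp add: E_def)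
  have D: "0 < D" using M(1) E r by (simp add: D_def add_pos_nonneg)
  have k: "0 < k" using D r by (simp add: k_def)
  have init': "v (x, 0) \<le> b + k * (max 0 ((dist y x)\<^sup>2 - r\<^sup>2))\<^sup>2" for x
  proof (cases "dist y x \<le> 2 * r")
    case True
    then show ?thesis
      using add_mono[OF init[OF True], of 0 "k * (max 0 ((dist y x)\<^sup>2 - r\<^sup>2))\<^sup>2"] k by simp
  next
    case False
    define \<rho> where "\<rho> = dist y x"
    have \<rho>: "2 * r \<le> \<rho>" using False by (simp add: \<rho>_def)
    have "v (x, 0) - b \<le> M * \<rho> + E" using M(2)[of 0 x] xt by (simp add: E_def \<rho>_def algebra_simps)
    also have "\<dots> \<le> D * \<rho>" using \<rho> r E mult_left_mono[of "2*r" \<rho> "E / (2*r)"] by (simp add: D_def algebra_simps)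
    also have "\<dots> = k * (r ^ 3 * \<rho>)" using r by (simp add: k_def)
    also have "\<dots> \<le> k * (r * \<rho>)\<^sup>2"
    proof -
      have "r * r * r * \<rho> \<le> r * r * \<rho> * \<rho>" using r \<rho> by (intro mult_mono) auto
      then show ?thesis using k by (intro mult_left_mono) (auto simp: power2_eq_square power3_eq_cube algebra_simps)
    qed
    also have "\<dots> \<le> k * (max 0 (\<rho>\<^sup>2 - r\<^sup>2))\<^sup>2"
    proof -
      have "2 * r * r \<le> \<rho> * (\<rho> - r)" using r \<rho> by (intro mult_mono) auto
      moreover have "0 \<le> r * r" by simp
      ultimately have "r * \<rho> \<le> \<rho>\<^sup>2 - r\<^sup>2" unfolding power2_eq_square right_diff_distrib
        using mult.commute[of \<rho> r] by linarith
      then show ?thesis using k r \<rho> by (intro mult_left_mono power_mono) auto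
    qed
    finally show ?thesis by (simp add: \<rho>_def)
  qed
  \<comment> \<open>\<open>Q\<close> bounds the squared radius of the moving ball up to time
    \<open>t1\<close>; the barrier then has quartic growth in \<open>R\<close> on the lateral
    boundary, uniformly in time.\<close>
  define Q where "Q = (r + c * t1)\<^sup>2"
  have "\<forall>\<^sub>F R in at_top. M * (R + norm y + 1) \<le> b + k * (R\<^sup>2 - Q)\<^sup>2" using k M(1) by real_asymp
  moreover have "\<forall>\<^sub>F R in at_top. Q \<le> R\<^sup>2" by real_asymp
  ultimately have "\<forall>\<^sub>F R in at_top. dist y x \<le> R \<and> Q \<le> R\<^sup>2 \<and> M * (R + norm y + 1) \<le> b + k * (R\<^sup>2 - Q)\<^sup>2"
    by (intro eventually_conj eventually_ge_at_top)
  then obtain R where R: "dist y x \<le> R" "Q \<le> R\<^sup>2" "M * (R + norm y + 1) \<le> b + k * (R\<^sup>2 - Q)\<^sup>2"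
    using eventually_happens'[OF trivial_limit_at_top_linorder] by blast
  define q where "q = (\<lambda>z::(real ^ 'n) \<times> real. (norm (fst z - y))\<^sup>2 + - (r + c * snd z)\<^sup>2)"
  define q' where "q' = (\<lambda>z::(real ^ 'n) \<times> real. (2 *\<^sub>R (fst z - y), - (2 * c * (r + c * snd z))))"
  define \<Phi> where "\<Phi> = (\<lambda>z. (b + e * snd z) + k * (max 0 (q z))\<^sup>2)"
  define G where "G = (\<lambda>z. (0, e) + k *\<^sub>R (2 * max 0 (q z)) *\<^sub>R q' z)"
  have q: "GDERIV q z :> q' z" for z
  proof -
    have "GDERIV (\<lambda>z. - (r + c * snd z)\<^sup>2) z :> (0 :: real ^ 'n, - (2 * c * (r + c * snd z)))"
      by (rule GDERIV_real_snd) (auto intro!: derivative_eq_intros)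
    from GDERIV_add[OF GDERIV_sqdist_fst this] show ?thesis by (simp add: q_def q'_def)
  qed
  have "GDERIV (\<lambda>z. b + e * snd z) z :> (0 :: real ^ 'n, e)" for z
    by (rule GDERIV_real_snd) (auto intro!: derivative_eq_intros)
  from GDERIV_add[OF this GDERIV_mult[OF GDERIV_const GDERIV_DERIV_compose[OF q DERIV_pos_part_sq]]]
  have "GDERIV \<Phi> z :> G z" for z
    unfolding \<Phi>_def G_def by simp
  then have C1: "C1_with_gradient spacetime \<Phi> G"
    unfolding C1_with_gradient_def G_def q_def q'_def by (auto intro!: continuous_intros)
  have cont\<Phi>: "continuous_on (cball y R \<times> {0..t1}) \<Phi>" unfolding \<Phi>_def q_def by (intro continuous_intros)
  have ge: "b + e * snd z \<le> \<Phi> z" for z using k by (simp add: \<Phi>_def)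
  have lateral: "v (x, t) \<le> \<Phi> (x, t)" if "dist y x = R" "0 \<le> t" "t \<le> t1" for x t
  proof -
    have "(r + c * t)\<^sup>2 \<le> Q" unfolding Q_def using r c that by (intro power_mono add_mono mult_left_mono) auto
    then have "R\<^sup>2 - Q \<le> q (x, t)" using that by (simp add: q_def dist_norm norm_minus_commute)
    then have "k * (R\<^sup>2 - Q)\<^sup>2 \<le> k * (max 0 (q (x, t)))\<^sup>2" using R(2) k by (intro mult_left_mono power_mono) auto
    moreover have "0 \<le> e * t" using e that by simp
    ultimately show ?thesis using M(2)[of t x] that R(3) by (simp add: \<Phi>_def)
  qed
  have ineq: "0 \<le> snd (G (x, t)) + norm (fst (G (x, t))) * F (x, t)"
    if "0 < t" "t < t1" "\<Phi> (x, t) < v (x, t)" for x t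
  proof -
    define \<rho> where "\<rho> = norm (x - y)"
    define m where "m = max 0 (q (x, t))"
    have m: "0 \<le> m" by (simp add: m_def)
    have cF: "c \<le> F (x, t)" using speed[of t x] that ge[of "(x, t)"] by auto
    have "norm (fst (G (x, t))) = 4 * k * m * \<rho>" using k m by (simp add: G_def \<rho>_def q'_def flip: m_def)
    moreover have "snd (G (x, t)) = e - 4 * k * m * c * (r + c * t)" using k by (simp add: G_def q'_def flip: m_def)
    ultimately have eq: "snd (G (x, t)) + norm (fst (G (x, t))) * F (x, t)
      = e + 4 * k * m * (\<rho> * F (x, t) - c * (r + c * t))" by (simp add: algebra_simps)
    have "0 \<le> m * (\<rho> * F (x, t) - c * (r + c * t))"
    \<comment> \<open>If \<open>m\<close> is nonzero, the point is outside the moving ball, so its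
      distance \<rho> is at least \<open>r + c * t\<close>, while \<open>F\<close> is at least
      \<open>c\<close>.\<close>
    proof (cases "m = 0")
      case False
      then have "(r + c * t)\<^sup>2 \<le> \<rho>\<^sup>2" by (auto simp: m_def q_def \<rho>_def max_def split: if_splits)
      then have "r + c * t \<le> \<rho>" by (rule power2_le_imp_le) (simp add: \<rho>_def)
      then have "(r + c * t) * c \<le> \<rho> * F (x, t)" using cF c by (intro mult_mono) (auto simp: \<rho>_def)
      then show ?thesis using m by (intro mult_nonneg_nonneg) (auto simp: mult.commute)
    qed simp
    then show ?thesis unfolding eq using k e by (simp add: mult.assoc)
  qed
  have "v (x, t) \<le> \<Phi> (x, t)"
    by (rule max_principle[OF C1 cont\<Phi> _ _ _ lateral ineq])
      (use init' xt R in \<open>auto simp: \<Phi>_def q_def dist_norm norm_minus_commute\<close>)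
  moreover have "q (x, t) \<le> 0"
    using xt power_mono[OF xt(1), of 2] by (simp add: q_def dist_norm norm_minus_commute)
  then have "max 0 (q (x, t)) = 0" by simp
  ultimately show ?thesis by (simp add: \<Phi>_def)
qed

lemma initial_ball:
  assumes "v (y, 0) < b"
  obtains r where "0 < r" "\<And>x. dist y x \<le> 2 * r \<Longrightarrow> v (x, 0) \<le> b"
proof -
  have "continuous_on UNIV (\<lambda>x. v (x, 0))"
    by (rule continuous_on_compose2[OF cont]) (auto intro!: continuous_intros)
  then have "open {x. v (x, 0) < b}" by (intro open_Collect_less continuous_intros)
  then obtain r where "0 < r" "cball y r \<subseteq> {x. v (x, 0) < b}"
    using assms open_contains_cball by blast
  then show thesis by (intro that[of "r / 2"]) (auto simp: subset_iff less_imp_le)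
qed

text \<open>The level rises at rate \<open>e\<close>, but near a point of contact a barrier rising
  at rate \<open>e / 2\<close> already suffices if its spatial gradient is small. It ends strictly
  below the level at \<open>(y, t0)\<close>.\<close>

lemma strictly_below_of_local_bound:
  assumes r: "0 < r" and e: "0 < e" and t0: "0 < t0"
    and le: "\<And>x t. dist y x \<le> r \<Longrightarrow> 0 \<le> t \<Longrightarrow> t \<le> t0 \<Longrightarrow> v (x, t) \<le> b + e * t"
  shows "v (y, t0) < b + e * t0"
proof -
  \<comment> \<open>The identity \<open>k * r\<^sup>2 = e * T / 2\<close> compensates on the sphere
    for the slower rise over a time \<open>T\<close>. The bound \<open>T \<le> r / (2 * C)\<close>
    keeps the gradient term \<open>2 * k * r * C\<close> at most \<open>e / 2\<close>.\<close>
  define T where "T = min t0 (r / (2 * C))"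
  define s where "s = t0 - T"
  define k where "k = e * T / (2 * r\<^sup>2)"
  have T: "0 < T" "T \<le> t0" "T \<le> r / (2 * C)" using r t0 C_pos by (auto simp: T_def)
  have k: "0 < k" "k * r\<^sup>2 = e * T / 2" "2 * k * r = e * T / r"
    using e T r by (auto simp: k_def power2_eq_square)
  define \<Phi> where "\<Phi> = (\<lambda>z :: (real ^ 'n) \<times> real. (b + e * snd z - e / 2 * (snd z - s)) + k * (norm (fst z - y))\<^sup>2)"
  define G where "G = (\<lambda>z :: (real ^ 'n) \<times> real. (0 :: real ^ 'n, e / 2) + k *\<^sub>R (2 *\<^sub>R (fst z - y), 0 :: real))"
  have "GDERIV (\<lambda>z. b + e * snd z - e / 2 * (snd z - s)) z :> (0 :: real ^ 'n, e / 2)" for z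
    by (rule GDERIV_real_snd) (auto intro!: derivative_eq_intros)
  from GDERIV_add[OF this GDERIV_mult[OF GDERIV_const GDERIV_sqdist_fst]]
  have "GDERIV \<Phi> z :> G z" for z unfolding \<Phi>_def G_def by simp
  then have C1: "C1_with_gradient spacetime \<Phi> G"
    unfolding C1_with_gradient_def G_def by (auto intro!: continuous_intros)
  have cont\<Phi>: "continuous_on (cball y r \<times> {s..t0}) \<Phi>" unfolding \<Phi>_def by (intro continuous_intros)
  have "v (y, t0) \<le> \<Phi> (y, t0)"
  proof (rule max_principle[OF C1 cont\<Phi>])
    show "v (x, s) \<le> \<Phi> (x, s)" if "x \<in> cball y r" for x
      using le[of x s] that T k(1) add_increasing2[of "k * (norm (x - y))\<^sup>2" "v (x, s)" "b + e * s"]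
      by (simp add: \<Phi>_def s_def)
    show "v (x, t) \<le> \<Phi> (x, t)" if "dist y x = r" "s \<le> t" "t \<le> t0" for x t
    proof -
      have "e / 2 * (t - s) \<le> e / 2 * T" using e that by (intro mult_left_mono) (auto simp: s_def)
      moreover have "norm (x - y) = r" using that by (simp add: dist_norm norm_minus_commute)
      moreover have "v (x, t) \<le> b + e * t" using le[of x t] that T by (simp add: s_def)
      ultimately show ?thesis using k(2) by (simp add: \<Phi>_def)
    qed
    show "0 \<le> snd (G (x, t)) + norm (fst (G (x, t))) * F (x, t)"
      if "dist y x < r" "s < t" "t < t0" "\<Phi> (x, t) < v (x, t)" for x t
    proof -
      have "norm (fst (G (x, t))) \<le> 2 * k * r"
        using that k(1) by (simp add: G_def dist_norm norm_minus_commute)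
      then have "norm (fst (G (x, t))) * \<bar>F (x, t)\<bar> \<le> 2 * k * r * C"
        using F_bound[of t x] that T k(1) r by (intro mult_mono) (auto simp: s_def)
      moreover have "2 * k * r * C \<le> e / 2"
      proof -
        have "e * T * C \<le> e * (r / (2 * C)) * C" using e T C_pos by (intro mult_right_mono mult_left_mono) auto
        then show ?thesis unfolding k(3) using r C_pos by (simp add: field_simps)
      qed
      moreover have "- (norm (fst (G (x, t))) * \<bar>F (x, t)\<bar>) \<le> norm (fst (G (x, t))) * F (x, t)"
        using mult_left_mono[of "- \<bar>F (x, t)\<bar>" "F (x, t)" "norm (fst (G (x, t)))"] by simp
      ultimately show ?thesis by (simp add: G_def)
    qed
  qed (use T r in \<open>auto simp: s_def\<close>)
  moreover have "0 < e * T" using e T by simp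
  ultimately show ?thesis by (simp add: \<Phi>_def s_def)
qed

text \<open>Finite speed: a flat paraboloid centred far out stays below \<open>b\<close> at its
  centre up to time \<open>S\<close>, yet lies above the possibly large initial values near the
  origin.\<close>

lemma far_below:
  assumes a: "\<And>x. R0 \<le> norm x \<Longrightarrow> v (x, 0) \<le> a" and ab: "a < b"
  shows "\<exists>R. \<forall>x. \<forall>t\<in>{0..S}. R \<le> norm x \<longrightarrow> v (x, t) < b"
proof -
  have "continuous_on (cball 0 R0) (\<lambda>x. v (x, 0))"
    by (rule continuous_on_compose2[OF cont]) (auto intro!: continuous_intros)
  then have "bdd_above ((\<lambda>x. v (x, 0)) ` cball 0 R0)"
    by (intro bounded_imp_bdd_above compact_imp_bounded compact_continuous_image) auto
  then obtain B where B: "\<And>x. norm x \<le> R0 \<Longrightarrow> v (x, 0) \<le> B"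
    unfolding bdd_above_def by force
  \<comment> \<open>At its centre the paraboloid rises to at most the midpoint of \<open>a\<close>
    and \<open>b\<close> by time \<open>S\<close>; \<rho> is a distance at which its quadratic part
    covers the gap \<open>B - a\<close>.\<close>
  define k where "k = (b - a) / (2 * exp (C * S))"
  have k: "0 < k" using ab by (simp add: k_def)
  define \<rho> where "\<rho> = sqrt (max 0 (B - a) / k)"
  have \<rho>: "0 \<le> \<rho>" "B - a \<le> k * \<rho>\<^sup>2" using k by (auto simp: \<rho>_def)
  have "v (y, t) < b" if y: "R0 + \<rho> \<le> norm y" and t: "t \<in> {0..S}" for y t
  proof -
    have init: "v (x, 0) \<le> a + k * ((dist y x)\<^sup>2 + 1)" for x
    proof (cases "R0 \<le> norm x")
      case True
      show ?thesis using add_mono[OF a[OF True], of 0 "k * ((dist y x)\<^sup>2 + 1)"] k by simp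
    next
      case False
      then have "\<rho> \<le> dist y x" using y norm_triangle_ineq2[of y x] by (simp add: dist_norm)
      then have "k * \<rho>\<^sup>2 \<le> k * (dist y x)\<^sup>2" using k \<rho> by (intro mult_left_mono power_mono) auto
      moreover have "v (x, 0) \<le> B" using False by (intro B) simp
      ultimately show ?thesis using \<rho>(2) k unfolding distrib_left by linarith
    qed
    have "v (y, t) \<le> a + k * exp (C * t)"
      using paraboloid_barrier[OF k init, of t y] t by simp
    also have "\<dots> \<le> a + k * exp (C * S)" using k t C_pos by simp
    also have "\<dots> = (a + b) / 2" by (simp add: k_def field_simps)
    also have "\<dots> < b" using ab by simp
    finally show ?thesis .
  qed
  then show ?thesis by blast
qed

section \<open>Propagation of a one-sided bound to compact sets\<close>

text \<open>\<open>speed\<close> is conditional on \<open>A\<close> staying below \<open>l\<close>,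
  because the coefficient sees the solution through the measure of a sublevel set. Its constant
  \<open>c\<close> is the same for all levels from \<open>b\<close> on, which leaves room for the
  level to rise. \<open>far\<close> confines contact on \<open>A\<close> to a bounded set.\<close>

lemma eventually_below:
  assumes A: "closed A" "A \<noteq> {}"
    and ab: "\<And>x. x \<in> A \<Longrightarrow> v (x, 0) < b"
    and far: "\<And>S. \<exists>R. \<forall>x\<in>A. \<forall>t\<in>{0..S}. R \<le> norm x \<longrightarrow> v (x, t) < b"
    and c: "0 < c"
    and speed: "\<And>x t l. 0 < t \<Longrightarrow> b \<le> l \<Longrightarrow> l < v (x, t) \<Longrightarrow> \<forall>y\<in>A. v (y, t) \<le> l \<Longrightarrow> c \<le> F (x, t)"
    and bh: "b < h" and K: "bounded K"
  shows "\<forall>\<^sub>F t in at_top. \<forall>x\<in>K. v (x, t) \<le> h"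
proof -
  obtain y0 where y0: "y0 \<in> A" using A by auto
  obtain \<rho> where \<rho>: "\<And>x. x \<in> K \<Longrightarrow> dist y0 x \<le> \<rho>"
    using K bounded_any_center[where a = y0] by blast
  have "v (x, S) \<le> h" if S: "max 1 (\<rho> / c) \<le> S" and x: "x \<in> K" for S x
  proof -
    have Spos: "0 < S" using S by auto
    \<comment> \<open>The level \<open>b + e * t\<close> reaches \<open>h\<close> exactly at time
      \<open>S\<close>; the slope depends on \<open>S\<close>, while \<open>c\<close> does
      not.\<close>
    define e where "e = (h - b) / S"
    have e: "0 < e" using Spos bh by (simp add: e_def)
    have below: "v (x, t) < b + e * t" if "x \<in> A" "t \<in> {0..S}" for x t
    proof (rule ccontr)
      assume neg: "\<not> v (x, t) < b + e * t"
      obtain R where R: "\<And>x t. x \<in> A \<Longrightarrow> t \<in> {0..S} \<Longrightarrow> R \<le> norm x \<Longrightarrow> v (x, t) < b"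
        using far[of S] by blast
      define D where "D = (A \<inter> cball 0 R) \<times> {0..S}"
      \<comment> \<open>\<open>Z\<close> collects the contacts with the level on the bounded part of
        \<open>A\<close>. It is compact, so a contact of least time exists.\<close>
      define Z where "Z = {z \<in> D. b + e * snd z \<le> v z}"
      have D: "compact D" unfolding D_def using A by (intro compact_Times closed_Int_compact) auto
      have "continuous_on D v" by (rule continuous_on_subset[OF cont]) (auto simp: D_def)
      then have "closed Z"
        unfolding Z_def using compact_imp_closed[OF D]
        by (intro continuous_on_closed_Collect_le continuous_intros)
      then have Z: "compact Z" using compact_Int_closed[OF D, of Z] by (simp add: Z_def Int_absorb1 Collect_conj_eq)
      have in_Z: "(x, t) \<in> Z" if "x \<in> A" "t \<in> {0..S}" "b + e * t \<le> v (x, t)" for x t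
      proof -
        have "0 \<le> e * t" using that e by simp
        then have "\<not> R \<le> norm x" using R[of x t] that by auto
        then show ?thesis using that by (auto simp: Z_def D_def)
      qed
      have "Z \<noteq> {}" using in_Z[OF that] neg by auto
      then obtain z where z: "z \<in> Z" "\<And>z'. z' \<in> Z \<Longrightarrow> snd z \<le> snd z'"
        using continuous_attains_inf[OF Z, of snd] continuous_on_snd[OF continuous_on_id] by fastforce
      obtain x0 t0 where z_eq: "z = (x0, t0)" by force
      have z0: "x0 \<in> A" "0 \<le> t0" "t0 \<le> S" "b + e * t0 \<le> v (x0, t0)" using z z_eq by (auto simp: Z_def D_def)
      have t0: "0 < t0"
      proof (rule ccontr)
        assume "\<not> 0 < t0"
        then have "t0 = 0" using z0 by simp
        then show False using ab[OF z0(1)] z0(4) by simp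
      qed
      \<comment> \<open>Before the first contact all of \<open>A\<close> is below the level, which
        is what \<open>speed\<close> asks for. The ball around \<open>x0\<close> therefore stays
        below the level up to \<open>t0\<close>, and the rise of the level then excludes the
        contact.\<close>
      have before: "v (y, t) \<le> b + e * t" if "y \<in> A" "0 < t" "t < t0" for y t
        using in_Z[of y t] z(2)[of "(y, t)"] that z0 z_eq by force
      obtain r where r: "0 < r" "\<And>x. dist x0 x \<le> 2 * r \<Longrightarrow> v (x, 0) \<le> b"
        using initial_ball[OF ab[OF z0(1)]] by blast
      have "v (x, t) \<le> b + e * t" if "dist x0 x \<le> r" "0 \<le> t" "t \<le> t0" for x t
      proof (rule expanding_barrier[OF r(1) less_imp_le[OF c] less_imp_le[OF e] r(2), where ?t1.0 = t0])
        show "c \<le> F (x, t)" if "0 < t" "t < t0" "b + e * t < v (x, t)" for x t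
          using that e before by (intro speed[of t "b + e * t" x]) auto
        have "0 \<le> c * t" using c \<open>0 \<le> t\<close> by simp
        then show "dist x0 x \<le> r + c * t" using \<open>dist x0 x \<le> r\<close> by simp
      qed (use that t0 in auto)
      from strictly_below_of_local_bound[where y = x0, OF r(1) e t0 this] z0(4) show False by simp
    qed
    \<comment> \<open>Now \<open>speed\<close> applies up to time \<open>S\<close>. As
      \<open>S\<close> is at least \<open>\<rho> / c\<close>, the ball growing around
      \<open>y0\<close> contains \<open>K\<close> by then.\<close>
    obtain r where r: "0 < r" "\<And>x. dist y0 x \<le> 2 * r \<Longrightarrow> v (x, 0) \<le> b"
      using initial_ball[OF ab[OF y0]] by blast
    have "v (x, S) \<le> b + e * S"
    proof (rule expanding_barrier[OF r(1) less_imp_le[OF c] less_imp_le[OF e] r(2), where ?t1.0 = S])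
      show "c \<le> F (x, t)" if "0 < t" "t < S" "b + e * t < v (x, t)" for x t
        using that e less_imp_le[OF below] by (intro speed[of t "b + e * t" x]) auto
      have "\<rho> \<le> c * S" using S c by (simp add: field_simps)
      then show "dist y0 x \<le> r + c * S" using \<rho>[OF x] r(1) by simp
    qed (use Spos in auto)
    then show ?thesis using Spos by (simp add: e_def)
  qed
  then show ?thesis unfolding eventually_at_top_linorder by blast
qed

end

section \<open>Properties of the measure and of the initial datum\<close>

lemma A3_nonneg:
  assumes "assumption_A3 \<mu>" "A \<in> sets lebesgue"
  shows "0 \<le> \<mu> A"
proof -
  obtain \<Theta> where "\<And>x. 0 < \<Theta> x" "\<mu> A = set_lebesgue_integral lebesgue A \<Theta>"
    using assms unfolding assumption_A3_def by blast
  then show ?thesis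
    unfolding set_lebesgue_integral_def by (simp add: integral_nonneg less_imp_le)
qed

text \<open>For strictness: if the positive density had integral zero over \<open>B - A\<close>,
  this set would be null and could not contain a nonempty open set.\<close>

lemma A3_measure_mono:
  assumes "assumption_A3 \<mu>" "A \<in> sets lebesgue" "B \<in> sets lebesgue" "A \<subseteq> B"
  shows A3_mono: "\<mu> A \<le> \<mu> B"
    and A3_strict_mono: "open U \<Longrightarrow> U \<noteq> {} \<Longrightarrow> U \<subseteq> B - A \<Longrightarrow> \<mu> A < \<mu> B"
proof -
  obtain \<Theta> where T: "integrable lebesgue \<Theta>" "\<And>x. 0 < \<Theta> x"
    and \<mu>: "\<And>A. A \<in> sets lebesgue \<Longrightarrow> \<mu> A = set_lebesgue_integral lebesgue A \<Theta>"
    using assms(1) unfolding assumption_A3_def by blast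
  have int: "set_integrable lebesgue D \<Theta>" if "D \<in> sets lebesgue" for D
    using integrable_mult_indicator[OF that T(1)] by (simp add: set_integrable_def)
  have BA: "B - A \<in> sets lebesgue" using assms by auto
  have "A \<union> (B - A) = B" using assms by auto
  then have split: "\<mu> B = \<mu> A + \<mu> (B - A)"
    using set_integral_Un[OF _ int[OF assms(2)] int[OF BA]] assms BA by (simp add: \<mu>)
  show "\<mu> A \<le> \<mu> B" using A3_nonneg[OF assms(1) BA] split by simp
  show "\<mu> A < \<mu> B" if U: "open U" "U \<noteq> {}" "U \<subseteq> B - A"
  proof (rule ccontr)
    assume "\<not> \<mu> A < \<mu> B"
    then have "(LINT x|lebesgue. indicator (B - A) x *\<^sub>R \<Theta> x) = 0"
      using A3_nonneg[OF assms(1) BA] split \<mu>[OF BA] by (simp add: set_lebesgue_integral_def)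
    moreover have "integrable lebesgue (\<lambda>x. indicator (B - A) x *\<^sub>R \<Theta> x)"
      using int[OF BA] by (simp add: set_integrable_def)
    ultimately have "AE x in lebesgue. indicator (B - A) x *\<^sub>R \<Theta> x = 0"
      using T(2) by (subst (asm) integral_nonneg_eq_0_iff_AE) (auto intro!: less_imp_le simp: indicator_def)
    then have "AE x in lebesgue. x \<notin> B - A"
      by eventually_elim (use T(2) in \<open>auto simp: indicator_def less_le split: if_splits\<close>)
    then have "B - A \<in> null_sets lebesgue" using AE_iff_null_sets[OF BA] by simp
    then have "negligible U" using U(3) negligible_subset by (auto simp: negligible_iff_null_sets)
    with open_not_negligible U show False by blast
  qed
qed

text \<open>Used to find levels strictly between \<open>hbar\<close> and a given bound. The range is
  an interval with values arbitrarily close to \<open>p\<close> and a value above \<open>p\<close>,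
  so it contains \<open>m\<close>, taken just to the right of \<open>p\<close>.\<close>

lemma range_meets_right_interval:
  fixes g :: "'a::real_normed_vector \<Rightarrow> real"
  assumes g: "continuous_on UNIV g" and p: "p \<in> closure (range g)" and "p < g x1" "p < a"
  shows "\<exists>y. p < g y \<and> g y < a"
proof -
  define e where "e = min (g x1 - p) (a - p)"
  have e: "0 < e" using assms by (simp add: e_def)
  obtain x2 where x2: "\<bar>g x2 - p\<bar> < e" using p e by (auto simp: closure_approachable dist_real_def)
  define m where "m = (max p (g x2) + (p + e)) / 2"
  have m: "p < m" "g x2 < m" "m < p + e" using x2 e by (auto simp: m_def max_def)
  have "connected (range g)" using connected_continuous_image[OF g connected_UNIV] .
  moreover have "m \<le> g x1" using m by (simp add: e_def)
  ultimately have "m \<in> range g" using m(2) unfolding connected_iff_interval by (meson less_imp_le rangeI)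
  then show ?thesis using m by (auto simp: e_def)
qed

text \<open>It makes the sublevel sets at attained values bounded, for the upper estimate, and keeps
  the datum high far out, for the lower one.\<close>

lemma A4_eventually_above:
  assumes "assumption_A4 u0"
  shows "\<exists>R. \<forall>y. R \<le> norm y \<longrightarrow> u0 x < u0 y"
proof -
  obtain L :: ereal where L: "((\<lambda>R::real. INF y \<in> {y. R \<le> norm y}. ereal (u0 y)) \<longlongrightarrow> L) at_top" "ereal (u0 x) < L"
    using assms unfolding assumption_A4_def by blast
  have "\<forall>\<^sub>F R :: real in at_top. ereal (u0 x) < (INF y \<in> {y. R \<le> norm y}. ereal (u0 y))"
    using order_tendstoD(1)[OF L] .
  then obtain R :: real where R: "ereal (u0 x) < (INF y \<in> {y. R \<le> norm y}. ereal (u0 y))"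
    using eventually_happens'[OF trivial_limit_at_top_linorder] by blast
  have "u0 x < u0 y" if "R \<le> norm y" for y
    using less_le_trans[OF R INF_lower[of y]] that by simp
  then show ?thesis by blast
qed

section \<open>Convergence from the two one-sided estimates\<close>

theorem proposition4p1:
  fixes f :: "real \<Rightarrow> real \<Rightarrow> real"
    and \<mu> :: "(real ^ 'n) set \<Rightarrow> real"
    and u0 :: "real ^ 'n \<Rightarrow> real"
    and u :: "(real ^ 'n) \<times> real \<Rightarrow> real"
    and hbar :: real
    and K :: "(real ^ 'n) set"
  assumes "assumption_A1 f"
    and "assumption_A2 f"
    and "assumption_A3 \<mu>"
    and "assumption_A4 u0"
    and "f hbar (\<mu> {y. u0 y < hbar}) \<le> 0"
    and "0 \<le> f hbar (\<mu> {y. u0 y \<le> hbar})"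
    and "hbar \<in> closure (range u0)"
    and "cauchy_viscosity_solution f \<mu> u0 u"
    and "growth_condition u"
    and "compact K"
  shows "uniform_limit K (\<lambda>t x. u (x, t)) (\<lambda>_. hbar) at_top"
proof -
  note A3 = \<open>assumption_A3 \<mu>\<close> and A4 = \<open>assumption_A4 u0\<close>
  have cont: "continuous_on (UNIV \<times> {0..}) u" and sub: "viscosity_subsolution f \<mu> u"
    and super: "viscosity_supersolution f \<mu> u" and init: "\<And>x. u (x, 0) = u0 x"
    using assms(8) by (auto simp: cauchy_viscosity_solution_def)
  have f_less: "f r q1 < f r q2" if "0 \<le> q1" "q1 < q2" for r q1 q2
    using assms(2) that unfolding assumption_A2_def by blast
  have f_mono: "f r1 q1 \<le> f r2 q2" if "r1 \<le> r2" "0 \<le> q1" "q1 \<le> q2" for r1 r2 q1 q2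
  proof -
    have "f r1 q1 \<le> f r2 q1" using assms(2) that unfolding assumption_A2_def by (cases "r1 = r2") auto
    also have "\<dots> \<le> f r2 q2" using f_less[of q1 q2 r2] that by (cases "q1 = q2") auto
    finally show ?thesis .
  qed
  have slice: "continuous_on UNIV (\<lambda>x. u (x, t))" if "0 \<le> t" for t
    by (rule continuous_on_compose2[OF cont]) (use that in \<open>auto intro!: continuous_intros\<close>)
  have u0_cont: "continuous_on UNIV u0" using slice[of 0] init by simp
  have sets: "{y. u (y, t) < l} \<in> sets lebesgue" "{y. u (y, t) \<le> l} \<in> sets lebesgue" if "0 \<le> t" for t l
    using open_Collect_less[OF slice[OF that] continuous_on_const[of _ l]]
      closed_Collect_le[OF slice[OF that] continuous_on_const[of _ l]]
    by (auto simp: borel_open borel_closed)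
  have sets0: "{y. u0 y < l} \<in> sets lebesgue" "{y. u0 y \<le> l} \<in> sets lebesgue" for l
    using sets[of 0 l] init by auto
  obtain C where C: "0 < C" "\<And>r q. 0 \<le> q \<Longrightarrow> \<bar>f r q\<bar> \<le> C"
    using assms(1) unfolding assumption_A1_def bounded_pos by fastforce
  interpret sub: eikonal_subsolution u "\<lambda>z. f (u z) (\<mu> {y. u (y, snd z) < u z})" C
  proof
    show "\<bar>f (u (x, t)) (\<mu> {y. u (y, snd (x, t)) < u (x, t)})\<bar> \<le> C" if "0 < t" for x t
      using that by (intro C(2) A3_nonneg[OF A3]) (simp add: sets)
  qed (use cont assms(9) C(1) sub in \<open>auto simp: viscosity_subsolution_def\<close>)
  \<comment> \<open>Reflecting both \<open>u\<close> and the test function turns minima into maxima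
    and keeps the gradient norm, so the coefficient changes sign while its nonstrict sublevel set is
    retained.\<close>
  interpret super: eikonal_subsolution "\<lambda>z. - u z" "\<lambda>z. - f (u z) (\<mu> {y. u (y, snd z) \<le> u z})" C
  proof
    show "continuous_on (UNIV \<times> {0..}) (\<lambda>z. - u z)" by (intro continuous_on_minus cont)
    show "growth_condition (\<lambda>z. - u z)" using assms(9) by (simp add: growth_condition_def)
    show "\<bar>- f (u (x, t)) (\<mu> {y. u (y, snd (x, t)) \<le> u (x, t)})\<bar> \<le> C" if "0 < t" for x t
      using C(2)[of "\<mu> {y. u (y, t) \<le> u (x, t)}"] A3_nonneg[OF A3] that by (simp add: sets)
    fix \<phi> :: "(real ^ 'n) \<times> real \<Rightarrow> real" and G and x0 :: "real ^ 'n" and t0 :: real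
    assume C1: "C1_with_gradient spacetime \<phi> G" and t0: "0 < t0"
      and max: "local_max_at (\<lambda>z. - u z - \<phi> z) (x0, t0)"
    have "C1_with_gradient spacetime (\<lambda>z. - \<phi> z) (\<lambda>z. - G z)"
      using C1 unfolding C1_with_gradient_def by (auto intro: GDERIV_minus continuous_on_minus)
    moreover have "local_min_at (\<lambda>z. u z - - \<phi> z) (x0, t0)"
      using max unfolding local_max_at_def local_min_at_def by eventually_elim simp
    ultimately have "0 \<le> snd (- G (x0, t0)) +
        norm (fst (- G (x0, t0))) * f (u (x0, t0)) (\<mu> {y. u (y, t0) \<le> u (x0, t0)})"
      using super t0 unfolding viscosity_supersolution_def by blast
    then show "snd (G (x0, t0)) + norm (fst (G (x0, t0))) *
        - f (u (x0, t0)) (\<mu> {y. u (y, snd (x0, t0)) \<le> u (x0, t0)}) \<le> 0"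
      by simp
  qed (rule C(1))
  have K: "bounded K" using assms(10) by (rule compact_imp_bounded)
  have upper: "\<forall>\<^sub>F t in at_top. \<forall>x\<in>K. u (x, t) \<le> h" if h: "hbar < h" for h
  proof (cases "\<exists>x. hbar < u0 x")
    case False
    then have "u (x, 0) \<le> hbar" for x by (simp add: init not_less)
    then have "u (x, t) \<le> hbar" if "0 \<le> t" for x t using that by (rule sub.upper_bound)
    then show ?thesis using h
      by (intro eventually_mono[OF eventually_ge_at_top[of 0]] ballI) (smt (verit))
  next
    case True
    \<comment> \<open>The value at \<open>y1\<close> fixes \<open>A\<close>. The point
      \<open>y2\<close> witnesses an open gap between \<open>{y. u0 y \<le> hbar}\<close> and
      \<open>A\<close>, so the measure, and with it \<open>f hbar\<close>, increases strictly and
      becomes positive.\<close>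
    then obtain y1 where y1: "hbar < u0 y1" "u0 y1 < h"
      using range_meets_right_interval[OF u0_cont assms(7) _ h] by blast
    obtain y2 where y2: "hbar < u0 y2" "u0 y2 < u0 y1"
      using range_meets_right_interval[OF u0_cont assms(7) y1(1) y1(1)] by blast
    define A where "A = {y. u0 y \<le> u0 y1}"
    have "open {y. hbar < u0 y \<and> u0 y < u0 y1}"
      using u0_cont by (intro open_Collect_conj open_Collect_less continuous_intros)
    then have "\<mu> {y. u0 y \<le> hbar} < \<mu> A"
      unfolding A_def using y1 y2
      by (intro A3_strict_mono[OF A3 sets0(2) sets0(2), where U = "{y. hbar < u0 y \<and> u0 y < u0 y1}"]) auto
    then have c: "0 < f hbar (\<mu> A)"
      using f_less[OF A3_nonneg[OF A3 sets0(2)], of hbar "\<mu> A" hbar] assms(6) by simp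
    obtain R where R: "\<And>y. R \<le> norm y \<Longrightarrow> u0 y1 < u0 y" using A4_eventually_above[OF A4] by blast
    show ?thesis
    proof (rule sub.eventually_below[OF _ _ _ _ c _ _ K])
      show "closed A" unfolding A_def using u0_cont by (intro closed_Collect_le continuous_intros)
      show "A \<noteq> {}" by (auto simp: A_def)
      show "u (x, 0) < (u0 y1 + h) / 2" if "x \<in> A" for x using that y1 by (auto simp: A_def init)
      \<comment> \<open>Here \<open>A\<close> has no points of norm at least
        \<open>R\<close>.\<close>
      show "\<exists>R. \<forall>x\<in>A. \<forall>t\<in>{0..S}. R \<le> norm x \<longrightarrow> u (x, t) < (u0 y1 + h) / 2" for S
        using R by (intro exI[of _ R]) (auto simp: A_def not_less[symmetric])
      \<comment> \<open>Since \<open>u \<le> l < u (x, t)\<close> on \<open>A\<close> at time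
        \<open>t\<close>, the strict sublevel set contains \<open>A\<close>; moreover
        \<open>u (x, t)\<close> exceeds \<open>hbar\<close>, and \<open>f\<close> is monotone in
        both arguments.\<close>
      show "f hbar (\<mu> A) \<le> f (u (x, t)) (\<mu> {y. u (y, snd (x, t)) < u (x, t)})"
        if "0 < t" "(u0 y1 + h) / 2 \<le> l" "l < u (x, t)" "\<forall>y\<in>A. u (y, t) \<le> l" for x t l
      proof (rule f_mono)
        show "hbar \<le> u (x, t)" using that y1 by simp
        show "0 \<le> \<mu> A" unfolding A_def by (rule A3_nonneg[OF A3 sets0(2)])
        show "\<mu> A \<le> \<mu> {y. u (y, snd (x, t)) < u (x, t)}"
          using that by (intro A3_mono[OF A3]) (auto simp: A_def sets sets0)
      qed
    qed (use y1 in simp)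
  qed
  have lower: "\<forall>\<^sub>F t in at_top. \<forall>x\<in>K. - u (x, t) \<le> - h" if h: "h < hbar" for h
  proof (cases "\<exists>x. u0 x < hbar")
    case False
    then have "- u (x, 0) \<le> - hbar" for x by (simp add: init not_less)
    then have "- u (x, t) \<le> - hbar" if "0 \<le> t" for x t using that by (rule super.upper_bound)
    then show ?thesis using h
      by (intro eventually_mono[OF eventually_ge_at_top[of 0]] ballI) (smt (verit))
  next
    case True
    have u0_cont': "continuous_on UNIV (\<lambda>x. - u0 x)" by (intro continuous_on_minus u0_cont)
    have "- hbar \<in> closure (range (\<lambda>x. - u0 x))"
      using assms(7) by (auto simp: closure_approachable dist_real_def abs_minus_commute)
    note meets = range_meets_right_interval[OF u0_cont' this]
    obtain y1 where y1: "u0 y1 < hbar" "h < u0 y1" using meets[of _ "- h"] True h by auto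
    obtain y2 where y2: "u0 y2 < hbar" "u0 y1 < u0 y2" using meets[of y1 "- u0 y1"] y1 by auto
    \<comment> \<open>For \<open>- u\<close> the set \<open>A\<close> is a superlevel set of
      \<open>u0\<close>. The coefficient is controlled by its complement, whose measure is strictly
      less than that of \<open>{y. u0 y < hbar}\<close>, so \<open>f hbar\<close> is negative
      there.\<close>
    define A where "A = {y. u0 y1 \<le> u0 y}"
    have A_compl: "- A = {y. u0 y < u0 y1}" by (auto simp: A_def)
    have "open {y. u0 y1 < u0 y \<and> u0 y < hbar}"
      using u0_cont by (intro open_Collect_conj open_Collect_less continuous_intros)
    then have "\<mu> (- A) < \<mu> {y. u0 y < hbar}"
      unfolding A_compl using y1 y2
      by (intro A3_strict_mono[OF A3 sets0(1) sets0(1), where U = "{y. u0 y1 < u0 y \<and> u0 y < hbar}"]) auto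
    moreover have "0 \<le> \<mu> (- A)" unfolding A_compl by (rule A3_nonneg[OF A3 sets0(1)])
    ultimately have c: "0 < - f hbar (\<mu> (- A))"
      using f_less[of "\<mu> (- A)" "\<mu> {y. u0 y < hbar}" hbar] assms(5) by simp
    obtain R where R: "\<And>y. R \<le> norm y \<Longrightarrow> u0 y1 < u0 y" using A4_eventually_above[OF A4] by blast
    show ?thesis
    proof (rule super.eventually_below[OF _ _ _ _ c _ _ K])
      show "closed A" unfolding A_def using u0_cont by (intro closed_Collect_le continuous_intros)
      show "A \<noteq> {}" by (auto simp: A_def)
      show "- u (x, 0) < - ((u0 y1 + h) / 2)" if "x \<in> A" for x using that y1 by (auto simp: A_def init)
      \<comment> \<open>This \<open>A\<close> is unbounded, so the behaviour far out has to come
        from finite speed.\<close>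
      show "\<exists>R. \<forall>x\<in>A. \<forall>t\<in>{0..S}. R \<le> norm x \<longrightarrow> - u (x, t) < - ((u0 y1 + h) / 2)" for S
        using super.far_below[of R "- u0 y1" "- ((u0 y1 + h) / 2)" S] R y1 by (force simp: init)
      show "- f hbar (\<mu> (- A)) \<le> - f (u (x, t)) (\<mu> {y. u (y, snd (x, t)) \<le> u (x, t)})"
        if "0 < t" "- ((u0 y1 + h) / 2) \<le> l" "l < - u (x, t)" "\<forall>y\<in>A. - u (y, t) \<le> l" for x t l
        unfolding neg_le_iff_le
      proof (rule f_mono)
        show "u (x, t) \<le> hbar" using that y1 by argo
        show "0 \<le> \<mu> {y. u (y, snd (x, t)) \<le> u (x, t)}"
          using that by (intro A3_nonneg[OF A3]) (simp add: sets)
        have "{y. u (y, t) \<le> u (x, t)} \<subseteq> - A" using that by force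
        then show "\<mu> {y. u (y, snd (x, t)) \<le> u (x, t)} \<le> \<mu> (- A)"
          using that by (intro A3_mono[OF A3]) (auto simp: A_compl sets sets0)
      qed
    qed (use y1 in simp)
  qed
  show ?thesis
  proof (rule uniform_limitI)
    fix e :: real assume "0 < e"
    then have "\<forall>\<^sub>F t in at_top. \<forall>x\<in>K. u (x, t) \<le> hbar + e / 2"
      "\<forall>\<^sub>F t in at_top. \<forall>x\<in>K. - u (x, t) \<le> - (hbar - e / 2)"
      by (intro upper lower; simp)+
    then show "\<forall>\<^sub>F t in at_top. \<forall>x\<in>K. dist (u (x, t)) hbar < e"
      by eventually_elim (use \<open>0 < e\<close> in \<open>force simp: dist_real_def\<close>)
  qed
qed

end
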